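(* Let $(\mathcal{L},\alpha)=(A,L,[-,-],\phi,\alpha,\rho)$ be a hom-Lie-Rinehart algebra over $(A,\phi)$, with $\phi$ an algebra automorphism of $A$, and let $(M,\beta)$ be a left module over $(\mathcal{L},\alpha)$ with action $\{-,-\}:L\otimes M\to M$. For $n\ge 1$ let $C^n(L;M)\subseteq Hom_R(\wedge^n_RL,M)$ be the set of $f$ satisfying $f(\alpha(x_1),\dots,\alpha(x_n))=\beta(f(x_1,\dots,x_n))$ and $f(x_1,\dots,a.x_i,\dots,x_n)=\phi^{n-1}(a)f(x_1,\dots,x_i,\dots,x_n)$ for all $x_1,\dots,x_n\in L$, $1\le i\le n$, $a\in A$. For $f\in C^n(L;M)$ define $$\delta f(x_1,\dots,x_{n+1})=\sum_{i=1}^{n+1}(-1)^{i+1}\{\alpha^{n-1}(x_i),f(x_1,\dots,\hat{x_i},\dots,x_{n+1})\}+\sum_{1\le i<j\le n+1}(-1)^{i+j}f([x_i,x_j],\alpha(x_1),\dots,\widehat{\alpha(x_i)},\dots,\widehat{\alpha(x_j)},\dots,\alpha(x_{n+1})).$$ If $f\in C^n(L;M)$, then $\delta f\in C^{n+1}(L;M)$; and $\delta^2=0$.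
   Context: $R$ is a commutative ring with unity; all modules, algebras, tensor products and linear maps are over $R$ unless stated otherwise. $A$ is an associative commutative $R$-algebra. A hat denotes omission; $\wedge^n_R$ is the exterior power over $R$. A hom-Lie algebra $(\mathfrak{g},[-,-],\alpha)$ is an $R$-module with a skew-symmetric ($[x,x]=0$) $R$-bilinear bracket and a linear map $\alpha$ with $\alpha[x,y]=[\alpha(x),\alpha(y)]$ and $[\alpha(x),[y,z]]+[\alpha(y),[z,x]]+[\alpha(z),[x,y]]=0$. A representation of it on an $R$-module $V$ is a pair $(\theta,\beta)$ of linear maps $\theta:\mathfrak{g}\to\mathrm{End}_R(V)$, $\beta:V\to V$ with $\theta(\alpha(x))\circ\beta=\beta\circ\theta(x)$ and $\theta([x,y])\circ\beta=\theta(\alpha(x))\circ\theta(y)-\theta(\alpha(y))\circ\theta(x)$. $Der_\phi(A)$ is the $A$-module of $R$-linear maps $\delta:A\to A$ with $\delta(ab)=\phi(a)\delta(b)+\phi(b)\delta(a)$. A hom-Lie-Rinehart algebra over $(A,\phi)$ is a tuple $(A,L,[-,-],\phi,\alpha,\rho)$ with $L$ an $A$-module, $[-,-]:L\times L\to L$ skew-symmetric $R$-bilinear, $\phi:A\to A$ an algebra homomorphism, $\alpha:L\to L$ linear with $\alpha[x,y]=[\alpha(x),\alpha(y)]$, and $\rho:L\to Der_\phi(A)$ $R$-linear, such that for all $a\in A$, $x,y\in L$: (1) $(L,[-,-],\alpha)$ is a hom-Lie algebra; (2) $\alpha(a.x)=\phi(a).\alpha(x)$; (3) $(\rho,\phi)$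 is a representation of $(L,[-,-],\alpha)$ on $A$; (4) $\rho(a.x)=\phi(a).\rho(x)$; (5) $[x,a.y]=\phi(a)[x,y]+\rho(x)(a)\alpha(y)$. A left module over it is a pair $(M,\beta)$ with $M$ an $A$-module, $\beta\in End_R(M)$, and a map $\theta:L\otimes M\to M$, $\theta(x,m)=\{x,m\}$, such that (1) $(\theta,\beta)$ is a representation of the hom-Lie algebra $(L,[-,-],\alpha)$ on $M$; (2) $\beta(a.m)=\phi(a).\beta(m)$; (3) $\{a.x,m\}=\phi(a)\{x,m\}$; (4) $\{x,a.m\}=\phi(a)\{x,m\}+\rho(x)(a).\beta(m)$. *)

theory Defs
  imports Complex_Main
begin

text \<open>
  The ground ring \<open>'r\<close> and all modules are types; \<open>module\<close> and \<open>module_hom\<close> are those of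
  \<^theory>\<open>HOL.Modules\<close>.  A commutative \<open>R\<close>-algebra is not assumed to have a unit, and a module over
  it is an \<open>R\<close>-module with a compatible \<open>R\<close>-bilinear associative action, so unital algebras with
  unital modules are a special case.
\<close>

locale comm_algebra = module scale
  for scale :: "'r::comm_ring_1 \<Rightarrow> 'a::comm_ring \<Rightarrow> 'a" +
  assumes scale_mult_left: "scale r (a * b) = scale r a * b"

locale algebra_module = A: comm_algebra scaleA + V: module scaleV
  for scaleA :: "'r::comm_ring_1 \<Rightarrow> 'a::comm_ring \<Rightarrow> 'a"
    and scaleV :: "'r \<Rightarrow> 'v::ab_group_add \<Rightarrow> 'v" +
  fixes act :: "'a \<Rightarrow> 'v \<Rightarrow> 'v"
  assumes act_linear_left: "module_hom scaleA scaleV (\<lambda>a. act a v)"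
    and act_linear_right: "module_hom scaleV scaleV (act a)"
    and act_mult: "act (a * b) v = act a (act b v)"

locale hom_lie_algebra = L: module scaleL
  for scaleL :: "'r::comm_ring_1 \<Rightarrow> 'l::ab_group_add \<Rightarrow> 'l" +
  fixes bracket :: "'l \<Rightarrow> 'l \<Rightarrow> 'l"
    and \<alpha> :: "'l \<Rightarrow> 'l"
  assumes bracket_linear_left: "module_hom scaleL scaleL (\<lambda>x. bracket x y)"
    and bracket_linear_right: "module_hom scaleL scaleL (bracket x)"
    and bracket_self: "bracket x x = 0"
    and alpha_linear: "module_hom scaleL scaleL \<alpha>"
    and alpha_bracket: "\<alpha> (bracket x y) = bracket (\<alpha> x) (\<alpha> y)"
    and hom_jacobi:
      "bracket (\<alpha> x) (bracket y z) + bracket (\<alpha> y) (bracket z x) + bracket (\<alpha> z) (bracket x y) = 0"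

locale hom_lie_representation = hom_lie_algebra scaleL bracket \<alpha> + V: module scaleV
  for scaleL :: "'r::comm_ring_1 \<Rightarrow> 'l::ab_group_add \<Rightarrow> 'l"
    and bracket :: "'l \<Rightarrow> 'l \<Rightarrow> 'l"
    and \<alpha> :: "'l \<Rightarrow> 'l"
    and scaleV :: "'r \<Rightarrow> 'v::ab_group_add \<Rightarrow> 'v" +
  fixes \<theta> :: "'l \<Rightarrow> 'v \<Rightarrow> 'v"
    and \<beta> :: "'v \<Rightarrow> 'v"
  assumes theta_endo: "module_hom scaleV scaleV (\<theta> x)"
    and theta_linear: "module_hom scaleL scaleV (\<lambda>x. \<theta> x v)"
    and beta_linear: "module_hom scaleV scaleV \<beta>"
    and theta_beta: "\<theta> (\<alpha> x) \<circ> \<beta> = \<beta> \<circ> \<theta> x"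
    and theta_bracket: "\<theta> (bracket x y) (\<beta> v) = \<theta> (\<alpha> x) (\<theta> y v) - \<theta> (\<alpha> y) (\<theta> x v)"

definition Der :: "('r::comm_ring_1 \<Rightarrow> 'a::comm_ring \<Rightarrow> 'a) \<Rightarrow> ('a \<Rightarrow> 'a) \<Rightarrow> ('a \<Rightarrow> 'a) set" where
  "Der scaleA \<phi> = {d. module_hom scaleA scaleA d \<and> (\<forall>a b. d (a * b) = \<phi> a * d b + \<phi> b * d a)}"

text \<open>
  Linearity of \<open>\<phi>\<close> and of \<open>\<rho>\<close> is contained in the assumption that \<open>(\<rho>, \<phi>)\<close> is a representation
  on \<open>A\<close>.
\<close>

locale hom_lie_rinehart_algebra =
  L: algebra_module scaleA scaleL actL +
  A: hom_lie_representation scaleL bracket \<alpha> scaleA \<rho> \<phi>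
  for scaleA :: "'r::comm_ring_1 \<Rightarrow> 'a::comm_ring \<Rightarrow> 'a"
    and scaleL :: "'r \<Rightarrow> 'l::ab_group_add \<Rightarrow> 'l"
    and actL :: "'a \<Rightarrow> 'l \<Rightarrow> 'l"
    and bracket :: "'l \<Rightarrow> 'l \<Rightarrow> 'l"
    and \<phi> :: "'a \<Rightarrow> 'a"
    and \<alpha> :: "'l \<Rightarrow> 'l"
    and \<rho> :: "'l \<Rightarrow> 'a \<Rightarrow> 'a" +
  assumes phi_mult: "\<phi> (a * b) = \<phi> a * \<phi> b"
    and rho_Der: "\<rho> x \<in> Der scaleA \<phi>"
    and alpha_act: "\<alpha> (actL a x) = actL (\<phi> a) (\<alpha> x)"
    and rho_act: "\<rho> (actL a x) b = \<phi> a * \<rho> x b"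
    and bracket_act: "bracket x (actL a y) = actL (\<phi> a) (bracket x y) + actL (\<rho> x a) (\<alpha> y)"

locale hom_lie_rinehart_left_module =
  hom_lie_rinehart_algebra scaleA scaleL actL bracket \<phi> \<alpha> \<rho> +
  M: algebra_module scaleA scaleM actM +
  M: hom_lie_representation scaleL bracket \<alpha> scaleM \<theta> \<beta>
  for scaleA :: "'r::comm_ring_1 \<Rightarrow> 'a::comm_ring \<Rightarrow> 'a"
    and scaleL :: "'r \<Rightarrow> 'l::ab_group_add \<Rightarrow> 'l"
    and actL :: "'a \<Rightarrow> 'l \<Rightarrow> 'l"
    and bracket :: "'l \<Rightarrow> 'l \<Rightarrow> 'l"
    and \<phi> :: "'a \<Rightarrow> 'a"
    and \<alpha> :: "'l \<Rightarrow> 'l"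
    and \<rho> :: "'l \<Rightarrow> 'a \<Rightarrow> 'a"
    and scaleM :: "'r \<Rightarrow> 'm::ab_group_add \<Rightarrow> 'm"
    and actM :: "'a \<Rightarrow> 'm \<Rightarrow> 'm"
    and \<theta> :: "'l \<Rightarrow> 'm \<Rightarrow> 'm"
    and \<beta> :: "'m \<Rightarrow> 'm" +
  assumes beta_act: "\<beta> (actM a m) = actM (\<phi> a) (\<beta> m)"
    and theta_act_left: "\<theta> (actL a x) m = actM (\<phi> a) (\<theta> x m)"
    and theta_act_right: "\<theta> x (actM a m) = actM (\<phi> a) (\<theta> x m) + actM (\<rho> x a) (\<beta> m)"

text \<open>
  \<open>Hom\<^sub>R(\<And>\<^sup>n L, M)\<close>, identified with the \<open>R\<close>-multilinear alternating maps \<open>L\<^sup>n \<rightarrow> M\<close>.  An \<open>n\<close>-tuple is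
  a list of length \<open>n\<close>; the value \<open>0\<close> on lists of any other length makes equality of such maps
  coincide with equality of HOL functions.
\<close>

definition alternating_maps ::
  "('r::comm_ring_1 \<Rightarrow> 'l::ab_group_add \<Rightarrow> 'l) \<Rightarrow> ('r \<Rightarrow> 'm::ab_group_add \<Rightarrow> 'm) \<Rightarrow> nat \<Rightarrow> ('l list \<Rightarrow> 'm) set"
  where
  "alternating_maps scaleL scaleM n = {f.
     (\<forall>xs. length xs \<noteq> n \<longrightarrow> f xs = 0) \<and>
     (\<forall>xs i. length xs = n \<longrightarrow> i < n \<longrightarrow> module_hom scaleL scaleM (\<lambda>x. f (xs[i := x]))) \<and>
     (\<forall>xs. length xs = n \<longrightarrow> \<not> distinct xs \<longrightarrow> f xs = 0)}"

definition cochains ::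
  "('r::comm_ring_1 \<Rightarrow> 'l::ab_group_add \<Rightarrow> 'l) \<Rightarrow> ('a \<Rightarrow> 'l \<Rightarrow> 'l) \<Rightarrow> ('a \<Rightarrow> 'a) \<Rightarrow> ('l \<Rightarrow> 'l) \<Rightarrow>
   ('r \<Rightarrow> 'm::ab_group_add \<Rightarrow> 'm) \<Rightarrow> ('a \<Rightarrow> 'm \<Rightarrow> 'm) \<Rightarrow> ('m \<Rightarrow> 'm) \<Rightarrow> nat \<Rightarrow> ('l list \<Rightarrow> 'm) set"
  where
  "cochains scaleL actL \<phi> \<alpha> scaleM actM \<beta> n = {f \<in> alternating_maps scaleL scaleM n.
     (\<forall>xs. length xs = n \<longrightarrow> f (map \<alpha> xs) = \<beta> (f xs)) \<and>
     (\<forall>xs i a. length xs = n \<longrightarrow> i < n \<longrightarrow>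
        f (xs[i := actL a (xs ! i)]) = actM ((\<phi> ^^ (n - 1)) a) (f xs))}"

text \<open>
  Indices start at \<open>0\<close>, so the signs \<open>(-1)\<^sup>i\<^sup>+\<^sup>1\<close> and \<open>(-1)\<^sup>i\<^sup>+\<^sup>j\<close> of the one-based formula become
  \<open>(-1)\<^sup>i\<close> and \<open>(-1)\<^sup>i\<^sup>+\<^sup>j\<close>.
\<close>

definition coboundary ::
  "('l \<Rightarrow> 'l \<Rightarrow> 'l) \<Rightarrow> ('l \<Rightarrow> 'l) \<Rightarrow> ('r::comm_ring_1 \<Rightarrow> 'm::ab_group_add \<Rightarrow> 'm) \<Rightarrow>
   ('l \<Rightarrow> 'm \<Rightarrow> 'm) \<Rightarrow> nat \<Rightarrow> ('l list \<Rightarrow> 'm) \<Rightarrow> 'l list \<Rightarrow> 'm"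
  where
  "coboundary bracket \<alpha> scaleM \<theta> n f xs =
     (if length xs = n + 1 then
        (\<Sum>i<n + 1. scaleM ((-1) ^ i) (\<theta> ((\<alpha> ^^ (n - 1)) (xs ! i)) (f (nths xs (- {i}))))) +
        (\<Sum>j<n + 1. \<Sum>i<j. scaleM ((-1) ^ (i + j))
           (f (bracket (xs ! i) (xs ! j) # map \<alpha> (nths xs (- {i, j})))))
      else 0)"

end

theory Submission
  imports Defs "HOL-Library.Multiset"
begin

text \<open>
  A signed sum over the ways of removing one entry, or an ordered pair of entries, from a list obeys a
  recursion on the list.  Writing the coboundary with these two operators reduces \<open>\<delta>\<^sup>2 = 0\<close> to
  identities for their four compositions, each proved by induction: removing one entry and then another
  gives the commutator term that the representation axiom matches with the bracket; removing an entry
  commutes with removing a pair, which cancels the mixed terms; and the remaining terms vanish by the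
  hom-Jacobi identity and by antisymmetry under exchanging two disjoint pairs.

  That \<open>\<delta> f\<close> is alternating is proved on lists with a repetition, since no division by \<open>2\<close> is
  available.  Then \<open>\<phi>\<close>-linearity of \<open>\<delta> f\<close> need only be checked in the first argument.
\<close>

fun alt_sum :: "('b \<Rightarrow> 'b list \<Rightarrow> 'c::ab_group_add) \<Rightarrow> 'b list \<Rightarrow> 'c" where
  "alt_sum G [] = 0"
| "alt_sum G (x # xs) = G x xs - alt_sum (\<lambda>y r. G y (x # r)) xs"

fun alt_sum2 :: "('b \<Rightarrow> 'b \<Rightarrow> 'b list \<Rightarrow> 'c::ab_group_add) \<Rightarrow> 'b list \<Rightarrow> 'c" where
  "alt_sum2 G [] = 0"
| "alt_sum2 G (x # xs) = alt_sum2 (\<lambda>y z r. G y z (x # r)) xs - alt_sum (G x) xs"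

lemma alt_sum_cong:
  "(\<And>y r. mset xs = add_mset y (mset r) \<Longrightarrow> G y r = H y r) \<Longrightarrow> alt_sum G xs = alt_sum H xs"
proof (induction xs arbitrary: G H)
  case (Cons x xs)
  have "alt_sum (\<lambda>y r. G y (x # r)) xs = alt_sum (\<lambda>y r. H y (x # r)) xs"
    by (rule Cons.IH) (auto intro!: Cons.prems)
  then show ?case using Cons.prems[of x xs] by simp
qed simp

lemma alt_sum2_cong:
  "(\<And>y z r. mset xs = add_mset y (add_mset z (mset r)) \<Longrightarrow> G y z r = H y z r) \<Longrightarrow>
    alt_sum2 G xs = alt_sum2 H xs"
proof (induction xs arbitrary: G H)
  case (Cons x xs)
  have "alt_sum2 (\<lambda>y z r. G y z (x # r)) xs = alt_sum2 (\<lambda>y z r. H y z (x # r)) xs"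
    by (rule Cons.IH) (auto intro!: Cons.prems)
  moreover have "alt_sum (G x) xs = alt_sum (H x) xs"
    by (rule alt_sum_cong) (auto intro!: Cons.prems)
  ultimately show ?case by simp
qed simp

lemma mset_eq_add_mset_D:
  assumes "mset xs = add_mset y (mset r)"
  shows "set xs = insert y (set r)" and "length xs = Suc (length r)"
  using arg_cong[OF assms, of set_mset] arg_cong[OF assms, of size] by simp_all

lemma alt_sum_zero: "alt_sum (\<lambda>_ _. 0) xs = 0"
  by (induction xs) auto

lemma alt_sum2_zero: "alt_sum2 (\<lambda>_ _ _. 0) xs = 0"
  by (induction xs) (auto simp: alt_sum_zero)

lemma alt_sum_diff: "alt_sum (\<lambda>y r. G y r - H y r) xs = alt_sum G xs - alt_sum H xs"
  by (induction xs arbitrary: G H) auto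

lemma alt_sum_minus: "alt_sum (\<lambda>y r. - G y r) xs = - alt_sum G xs"
  using alt_sum_diff[of "\<lambda>_ _. 0" G xs] by (simp add: alt_sum_zero)

lemma alt_sum_add: "alt_sum (\<lambda>y r. G y r + H y r) xs = alt_sum G xs + alt_sum H xs"
  using alt_sum_diff[of G "\<lambda>y r. - H y r" xs] by (simp add: alt_sum_minus)

lemma alt_sum2_diff: "alt_sum2 (\<lambda>y z r. G y z r - H y z r) xs = alt_sum2 G xs - alt_sum2 H xs"
  by (induction xs arbitrary: G H) (auto simp: alt_sum_diff)

lemma alt_sum2_minus: "alt_sum2 (\<lambda>y z r. - G y z r) xs = - alt_sum2 G xs"
  using alt_sum2_diff[of "\<lambda>_ _ _. 0" G xs] by (simp add: alt_sum2_zero)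

lemma alt_sum2_add: "alt_sum2 (\<lambda>y z r. G y z r + H y z r) xs = alt_sum2 G xs + alt_sum2 H xs"
  using alt_sum2_diff[of G "\<lambda>y z r. - H y z r" xs] by (simp add: alt_sum2_minus)

lemma alt_sum_image:
  assumes "\<And>u v. h (u - v) = h u - h v"
  shows "h (alt_sum G xs) = alt_sum (\<lambda>y r. h (G y r)) xs"
proof (induction xs arbitrary: G)
  case Nil
  show ?case using assms[of 0 0] by simp
next
  case (Cons x xs)
  show ?case unfolding alt_sum.simps assms Cons.IH ..
qed

lemma alt_sum2_image:
  assumes "\<And>u v. h (u - v) = h u - h v"
  shows "h (alt_sum2 G xs) = alt_sum2 (\<lambda>y z r. h (G y z r)) xs"
proof (induction xs arbitrary: G)
  case Nil
  show ?case using assms[of 0 0] by simp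
next
  case (Cons x xs)
  show ?case unfolding alt_sum2.simps assms Cons.IH
    by (subst alt_sum_image[where h = h, OF assms]) (rule refl)
qed

lemma alt_sum_map: "alt_sum G (map h xs) = alt_sum (\<lambda>y r. G (h y) (map h r)) xs"
  by (induction xs arbitrary: G) auto

lemma alt_sum2_map: "alt_sum2 G (map h xs) = alt_sum2 (\<lambda>y z r. G (h y) (h z) (map h r)) xs"
  by (induction xs arbitrary: G) (auto simp: alt_sum_map)

lemma alt_sum_alt_sum:
  "alt_sum (\<lambda>x. alt_sum (G x)) xs = alt_sum2 (\<lambda>x y r. G y x r - G x y r) xs"
proof (induction xs arbitrary: G)
  case (Cons x xs)
  show ?case
    using Cons.IH[of "\<lambda>y z r. G y z (x # r)"]
    by (simp add: alt_sum_diff)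
qed simp

lemma alt_sum_alt_sum_swap: "alt_sum (\<lambda>x. alt_sum (G x)) xs = - alt_sum (\<lambda>y. alt_sum (\<lambda>x. G x y)) xs"
  unfolding alt_sum_alt_sum by (simp add: alt_sum2_diff)

lemma alt_sum_alt_sum2_commute:
  "alt_sum (\<lambda>x. alt_sum2 (G x)) xs = alt_sum2 (\<lambda>y z. alt_sum (\<lambda>x. G x y z)) xs"
proof (induction xs arbitrary: G)
  case (Cons w xs)
  show ?case
    using Cons.IH[of "\<lambda>x y z r. G x y z (w # r)"] alt_sum_alt_sum_swap[of "\<lambda>x y. G x w y" xs]
    by (simp add: alt_sum_diff alt_sum2_diff)
qed simp

lemma alt_sum2_alt_sum_cyclic:
  assumes "\<And>x y z r. G x y z r = - G y x z r"
    and "\<And>x y z r. G x y z r + G y z x r + G z x y r = 0"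
  shows "alt_sum2 (\<lambda>x y. alt_sum (G x y)) xs = 0"
  using assms
proof (induction xs arbitrary: G)
  case Nil
  show ?case by simp
next
  case (Cons w xs)
  have IH: "alt_sum2 (\<lambda>x y. alt_sum (\<lambda>z r. G x y z (w # r))) xs = 0"
    by (rule Cons.IH) (rule Cons.prems)+
  have "G y z w r - (G w z y r - G w y z r) = 0" for y z r
    using Cons.prems(2)[of w y z r] Cons.prems(1)[of w z y r] by (simp add: algebra_simps)
  then have "alt_sum2 (\<lambda>y z r. G y z w r - (G w z y r - G w y z r)) xs = 0"
    by (simp add: alt_sum2_zero)
  then show ?case
    using IH by (simp add: alt_sum2_diff alt_sum_alt_sum)
qed

lemma alt_sum2_alt_sum2_antisym:
  assumes "\<And>x y z w r. G x y z w r = - G z w x y r"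
  shows "alt_sum2 (\<lambda>x y. alt_sum2 (G x y)) xs = 0"
  using assms
proof (induction xs arbitrary: G)
  case Nil
  show ?case by simp
next
  case (Cons v xs)
  have IH: "alt_sum2 (\<lambda>x y. alt_sum2 (\<lambda>z w r. G x y z w (v # r))) xs = 0"
    by (rule Cons.IH) (rule Cons.prems)
  have "alt_sum2 (\<lambda>y z. alt_sum (\<lambda>x. G v x y z)) xs = alt_sum2 (\<lambda>y z r. - alt_sum (G y z v) r) xs"
    unfolding alt_sum_minus[symmetric]
    by (intro alt_sum2_cong alt_sum_cong) (rule Cons.prems)
  then show ?case
    using IH alt_sum_alt_sum2_commute[of "G v" xs] by (simp add: alt_sum2_diff alt_sum2_minus)
qed

definition alternating ::
  "('r::comm_ring_1 \<Rightarrow> 'b::ab_group_add \<Rightarrow> 'b) \<Rightarrow> ('r \<Rightarrow> 'c::ab_group_add \<Rightarrow> 'c) \<Rightarrow> nat \<Rightarrow> ('b list \<Rightarrow> 'c) \<Rightarrow> bool"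
  where
  "alternating s1 s2 n g \<longleftrightarrow>
     (\<forall>xs i. length xs = n \<longrightarrow> i < n \<longrightarrow> module_hom s1 s2 (\<lambda>x. g (xs[i := x]))) \<and>
     (\<forall>xs. length xs = n \<longrightarrow> \<not> distinct xs \<longrightarrow> g xs = 0)"

lemma alternating_update:
  "alternating s1 s2 n g \<Longrightarrow> length xs = n \<Longrightarrow> i < n \<Longrightarrow> module_hom s1 s2 (\<lambda>x. g (xs[i := x]))"
  by (simp add: alternating_def)

lemma alternating_not_distinct:
  "alternating s1 s2 n g \<Longrightarrow> length xs = n \<Longrightarrow> \<not> distinct xs \<Longrightarrow> g xs = 0"
  by (simp add: alternating_def)

lemma alternating_head:
  assumes "alternating s1 s2 (Suc n) g" and "length r = n"
  shows "module_hom s1 s2 (\<lambda>y. g (y # r))"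
  using alternating_update[OF assms(1), of "0 # r" 0] assms(2) by simp

lemma alternating_Cons:
  assumes "alternating s1 s2 (Suc n) g"
  shows "alternating s1 s2 n (\<lambda>r. g (y # r))"
proof -
  have "module_hom s1 s2 (\<lambda>x. g (y # xs[i := x]))" if "length xs = n" "i < n" for xs i
    using alternating_update[OF assms, of "y # xs" "Suc i"] that by simp
  then show ?thesis
    using alternating_not_distinct[OF assms] by (auto simp: alternating_def)
qed

lemma skew_if_self_zero:
  assumes "\<And>x. module_hom s1 s2 (\<lambda>y. g x y)" and "\<And>y. module_hom s1 s2 (\<lambda>x. g x y)"
    and "\<And>x. g x x = 0"
  shows "g x y = - g y x"
proof -
  have "g (x + y) (x + y) = g x x + g x y + (g y x + g y y)"
    unfolding module_hom.add[OF assms(1)] module_hom.add[OF assms(2)] by (simp add: ac_simps)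
  then have "g x y + g y x = 0" unfolding assms(3) by simp
  then show ?thesis by (simp add: eq_neg_iff_add_eq_0)
qed

lemma alternating_swap:
  assumes "alternating s1 s2 (Suc (Suc n)) g" and "length r = n"
  shows "g (x # y # r) = - g (y # x # r)"
proof (rule skew_if_self_zero[where g = "\<lambda>x y. g (x # y # r)"])
  show "module_hom s1 s2 (\<lambda>z. g (x # z # r))" for x
    using alternating_head[OF alternating_Cons[OF assms(1)] assms(2)] .
  show "module_hom s1 s2 (\<lambda>z. g (z # y # r))" for y
    using alternating_head[OF assms(1)] assms(2) by simp
  show "g (z # z # r) = 0" for z
    using alternating_not_distinct[OF assms(1)] assms(2) by simp
qed

lemma alternating_compose:
  assumes "alternating s1 s2 n g" and "module_hom s2 s3 h"
  shows "alternating s1 s3 n (\<lambda>r. h (g r))"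
  unfolding alternating_def
proof (intro conjI allI impI)
  fix xs :: "'b list" and i assume "length xs = n" "i < n"
  show "module_hom s1 s3 (\<lambda>x. h (g (xs[i := x])))"
    using module_hom_compose[OF alternating_update[OF assms(1) \<open>length xs = n\<close> \<open>i < n\<close>] assms(2)]
    by (simp add: o_def)
next
  fix xs :: "'b list" assume "length xs = n" "\<not> distinct xs"
  then show "h (g xs) = 0"
    using alternating_not_distinct[OF assms(1)] module_hom.zero[OF assms(2)] by simp
qed

lemma alternating_map:
  fixes h :: "'d::ab_group_add \<Rightarrow> 'b::ab_group_add"
  assumes "alternating s1 s2 n g" and "module_hom s0 s1 h"
  shows "alternating s0 s2 n (\<lambda>r. g (map h r))"
  unfolding alternating_def
proof (intro conjI allI impI)
  fix xs :: "'d list" and i assume "length xs = n" "i < n"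
  then show "module_hom s0 s2 (\<lambda>x. g (map h (xs[i := x])))"
    using module_hom_compose[OF assms(2) alternating_update[OF assms(1), of "map h xs" i]]
    by (simp add: o_def map_update)
next
  fix xs :: "'d list" assume "length xs = n" "\<not> distinct xs"
  then show "g (map h xs) = 0"
    using alternating_not_distinct[OF assms(1), of "map h xs"] by (simp add: distinct_map)
qed

context module_pair
begin

lemma alternating_move_to_front:
  "alternating s1 s2 n g \<Longrightarrow> length (u @ x # v) = n \<Longrightarrow>
    g (u @ x # v) = s2 ((-1) ^ length u) (g (x # u @ v))"
proof (induction u arbitrary: g n)
  case (Cons w u)
  then obtain m where n: "n = Suc (Suc m)" and m: "length (u @ v) = m" by (cases n) auto
  have "g (w # u @ x # v) = s2 ((-1) ^ length u) (g (w # x # u @ v))"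
    by (rule Cons.IH[where n = "Suc m"]) (use Cons.prems n m in \<open>auto intro: alternating_Cons\<close>)
  also have "g (w # x # u @ v) = - g (x # w # u @ v)"
    by (rule alternating_swap[where n = m]) (use Cons.prems n m in auto)
  finally show ?case by simp
qed simp

lemma hom_alt_sum:
  "(\<And>y r. length ys = Suc (length r) \<Longrightarrow> module_hom s1 s2 (\<lambda>z. H z y r)) \<Longrightarrow>
    module_hom s1 s2 (\<lambda>z. alt_sum (H z) ys)"
proof (induction ys arbitrary: H)
  case Nil
  show ?case by (simp add: module_hom_zero)
next
  case (Cons x ys)
  have "module_hom s1 s2 (\<lambda>z. alt_sum (\<lambda>y r. H z y (x # r)) ys)"
    by (rule Cons.IH) (use Cons.prems in simp)
  then show ?case using Cons.prems by (simp add: module_hom_sub)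
qed

lemma hom_alt_sum2:
  "(\<And>y w r. length ys = Suc (Suc (length r)) \<Longrightarrow> module_hom s1 s2 (\<lambda>z. H z y w r)) \<Longrightarrow>
    module_hom s1 s2 (\<lambda>z. alt_sum2 (H z) ys)"
proof (induction ys arbitrary: H)
  case Nil
  show ?case by (simp add: module_hom_zero)
next
  case (Cons x ys)
  have "module_hom s1 s2 (\<lambda>z. alt_sum2 (\<lambda>y w r. H z y w (x # r)) ys)"
    by (rule Cons.IH) (use Cons.prems in simp)
  then show ?case using Cons.prems by (simp add: module_hom_sub hom_alt_sum)
qed

lemma hom_alt_sum_update:
  assumes "\<And>y. alternating s1 s2 n (G y)"
    and "\<And>r. length r = n \<Longrightarrow> module_hom s1 s2 (\<lambda>y. G y r)"
    and "length xs = Suc n" and "i < Suc n"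
  shows "module_hom s1 s2 (\<lambda>z. alt_sum G (xs[i := z]))"
  using assms
proof (induction xs arbitrary: n i G)
  case (Cons x xs)
  have len: "length xs = n" using Cons.prems by simp
  show ?case
  proof (cases i)
    case 0
    have "module_hom s1 s2 (\<lambda>z. alt_sum (\<lambda>y r. G y (z # r)) xs)"
      by (rule hom_alt_sum) (use Cons.prems(1) len in \<open>auto intro: alternating_head\<close>)
    then show ?thesis using 0 Cons.prems(2) len by (simp add: module_hom_sub)
  next
    case (Suc k)
    then obtain m where m: "n = Suc m" "k < Suc m" using Cons.prems(4) by (cases n) auto
    have "module_hom s1 s2 (\<lambda>z. alt_sum (\<lambda>y r. G y (x # r)) (xs[k := z]))"
      by (rule Cons.IH[of m]) (use Cons.prems m len in \<open>auto intro: alternating_Cons\<close>)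
    moreover have "module_hom s1 s2 (\<lambda>z. G x (xs[k := z]))"
      using alternating_update[OF Cons.prems(1)] m len by simp
    ultimately show ?thesis using Suc by (simp add: module_hom_sub)
  qed
qed simp

lemma hom_alt_sum2_update:
  assumes "\<And>y z. alternating s1 s2 n (G y z)"
    and "\<And>z r. length r = n \<Longrightarrow> module_hom s1 s2 (\<lambda>y. G y z r)"
    and "\<And>y r. length r = n \<Longrightarrow> module_hom s1 s2 (\<lambda>z. G y z r)"
    and "length xs = Suc (Suc n)" and "i < Suc (Suc n)"
  shows "module_hom s1 s2 (\<lambda>z. alt_sum2 G (xs[i := z]))"
  using assms
proof (induction xs arbitrary: n i G)
  case (Cons x xs)
  have len: "length xs = Suc n" using Cons.prems by simp
  show ?case
  proof (cases i)
    case 0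
    have "module_hom s1 s2 (\<lambda>z. alt_sum2 (\<lambda>y w r. G y w (z # r)) xs)"
      by (rule hom_alt_sum2) (use Cons.prems(1) len in \<open>auto intro: alternating_head\<close>)
    moreover have "module_hom s1 s2 (\<lambda>z. alt_sum (G z) xs)"
      by (rule hom_alt_sum) (use Cons.prems(2) len in simp)
    ultimately show ?thesis using 0 by (simp add: module_hom_sub)
  next
    case (Suc k)
    then have k: "k < Suc n" using Cons.prems(5) by simp
    have "module_hom s1 s2 (\<lambda>z. alt_sum2 (\<lambda>y w r. G y w (x # r)) (xs[k := z]))"
    proof (cases n)
      case 0
      then show ?thesis using len k by (cases xs) (auto simp: module_hom_zero)
    next
      case (Suc m)
      show ?thesis
        by (rule Cons.IH[of m]) (use Cons.prems Suc len k in \<open>auto intro: alternating_Cons\<close>)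
    qed
    moreover have "module_hom s1 s2 (\<lambda>z. alt_sum (G x) (xs[k := z]))"
      by (rule hom_alt_sum_update[of n]) (use Cons.prems len k in auto)
    ultimately show ?thesis using Suc by (simp add: module_hom_sub)
  qed
qed simp

lemma alt_sum_at:
  assumes "alternating s1 s2 (length ys) g" and "distinct ys" and "x \<in> set ys"
  shows "alt_sum (\<lambda>y r. if y = x then g (x # r) else 0) ys = g ys"
  using assms
proof (induction ys arbitrary: g)
  case (Cons y ys)
  show ?case
  proof (cases "y = x")
    case True
    have "alt_sum (\<lambda>w r. if w = x then g (x # x # r) else 0) ys = alt_sum (\<lambda>_ _. 0) ys"
      by (rule alt_sum_cong) (use Cons.prems(2) True in \<open>auto dest: mset_eq_add_mset_D(1)\<close>)
    then show ?thesis using True by (simp add: alt_sum_zero)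
  next
    case False
    then have x: "x \<in> set ys" using Cons.prems(3) by simp
    have "alt_sum (\<lambda>w r. if w = x then g (x # y # r) else 0) ys
        = alt_sum (\<lambda>w r. - (if w = x then g (y # x # r) else 0)) ys"
    proof (rule alt_sum_cong)
      fix w r assume "mset ys = add_mset w (mset r)"
      then have "length ys = Suc (length r)" by (rule mset_eq_add_mset_D)
      then show "(if w = x then g (x # y # r) else 0) = - (if w = x then g (y # x # r) else 0)"
        using alternating_swap[of s1 s2 "length r" g r x y] Cons.prems(1) by simp
    qed
    also have "\<dots> = - g (y # ys)"
      unfolding alt_sum_minus
      using Cons.IH[of "\<lambda>r. g (y # r)"] alternating_Cons[of s1 s2 "length ys" g y] Cons.prems x
      by simp
    finally show ?thesis using False by simp
  qed
qed simp

lemma alt_sum_not_distinct: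
  assumes "\<And>y. alternating s1 s2 n (G y)" and "length xs = Suc n" and "\<not> distinct xs"
  shows "alt_sum G xs = 0"
  using assms
proof (induction xs arbitrary: n G)
  case (Cons x ys)
  then have len: "length ys = n" by simp
  obtain m where n: "n = Suc m" using Cons.prems(2,3) by (cases n) auto
  show ?case
  proof (cases "distinct ys")
    case False
    have "alt_sum (\<lambda>y r. G y (x # r)) ys = 0"
      by (rule Cons.IH[of m]) (use Cons.prems n False in \<open>auto intro: alternating_Cons\<close>)
    then show ?thesis using alternating_not_distinct[OF Cons.prems(1) len False] by simp
  next
    case True
    then have x: "x \<in> set ys" using Cons.prems(3) by simp
    have "alt_sum (\<lambda>y r. G y (x # r)) ys = alt_sum (\<lambda>y r. if y = x then G x (x # r) else 0) ys"
    proof (rule alt_sum_cong)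
      fix y r assume *: "mset ys = add_mset y (mset r)"
      have "length ys = Suc (length r)" using arg_cong[OF *, of size] by simp
      moreover have "x \<in> set r" if "y \<noteq> x"
        using mset_eq_add_mset_D(1)[OF *] x that by simp
      ultimately show "G y (x # r) = (if y = x then G x (x # r) else 0)"
        using alternating_not_distinct[OF Cons.prems(1), of "x # r"] len by auto
    qed
    also have "\<dots> = G x ys"
      using alt_sum_at[of ys "G x" x] Cons.prems(1) len True x by simp
    finally show ?thesis by simp
  qed
qed simp

lemma alt_sum2_at:
  assumes "\<And>y z. alternating s1 s2 n (G y z)"
    and "\<And>y z r. length r = n \<Longrightarrow> G y z r + G z y r = 0"
    and "\<And>y r. length r = n \<Longrightarrow> G y y r = 0"
    and "length ys = Suc n" and "distinct ys" and "x \<in> set ys"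
  shows "alt_sum2 (\<lambda>y z r. G y z (x # r)) ys = alt_sum (G x) ys"
  using assms
proof (induction ys arbitrary: n G)
  case (Cons y ys)
  then have len: "length ys = n" by simp
  show ?case
  proof (cases "y = x")
    case True
    have "alt_sum2 (\<lambda>w z r. G w z (x # x # r)) ys = alt_sum2 (\<lambda>_ _ _. 0) ys"
    proof (rule alt_sum2_cong)
      fix w z r assume *: "mset ys = add_mset w (add_mset z (mset r))"
      have "length ys = Suc (Suc (length r))" using arg_cong[OF *, of size] by simp
      then show "G w z (x # x # r) = 0"
        using alternating_not_distinct[OF Cons.prems(1), of "x # x # r"] len by simp
    qed
    then show ?thesis using True Cons.prems(3) len by (simp add: alt_sum2_zero)
  next
    case False
    then have x: "x \<in> set ys" using Cons.prems(6) by simp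
    then obtain m where n: "n = Suc m" using len by (cases n) auto
    have "alt_sum2 (\<lambda>w z r. G w z (x # y # r)) ys = alt_sum2 (\<lambda>w z r. - G w z (y # x # r)) ys"
    proof (rule alt_sum2_cong)
      fix w z r assume *: "mset ys = add_mset w (add_mset z (mset r))"
      have "length ys = Suc (Suc (length r))" using arg_cong[OF *, of size] by simp
      then show "G w z (x # y # r) = - G w z (y # x # r)"
        using alternating_swap[of s1 s2 "length r" "G w z" r x y] Cons.prems(1) len by simp
    qed
    also have "\<dots> = - alt_sum (\<lambda>z r. G x z (y # r)) ys"
      unfolding alt_sum2_minus
      using Cons.IH[of m "\<lambda>w z r. G w z (y # r)"] alternating_Cons[OF Cons.prems(1)[unfolded n]]
        Cons.prems n x by simp
    finally have 1: "alt_sum2 (\<lambda>w z r. G w z (x # y # r)) ys = - alt_sum (\<lambda>z r. G x z (y # r)) ys" .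
    have "alt_sum (\<lambda>z r. G y z (x # r)) ys = alt_sum (\<lambda>z r. if z = x then G y x (x # r) else 0) ys"
    proof (rule alt_sum_cong)
      fix z r assume *: "mset ys = add_mset z (mset r)"
      have "length ys = Suc (length r)" using arg_cong[OF *, of size] by simp
      moreover have "x \<in> set r" if "z \<noteq> x"
        using mset_eq_add_mset_D(1)[OF *] x that by simp
      ultimately show "G y z (x # r) = (if z = x then G y x (x # r) else 0)"
        using alternating_not_distinct[OF Cons.prems(1), of "x # r"] len by auto
    qed
    also have "\<dots> = G y x ys"
      using alt_sum_at[of ys "G y x" x] Cons.prems len x by simp
    finally show ?thesis using 1 Cons.prems(2)[OF len, of x y] by (simp add: add_eq_0_iff)
  qed
qed simp

lemma alt_sum2_not_distinct:
  assumes "\<And>y z. alternating s1 s2 n (G y z)"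
    and "\<And>y z r. length r = n \<Longrightarrow> G y z r + G z y r = 0"
    and "\<And>y r. length r = n \<Longrightarrow> G y y r = 0"
    and "length xs = Suc (Suc n)" and "\<not> distinct xs"
  shows "alt_sum2 G xs = 0"
  using assms
proof (induction xs arbitrary: n G)
  case (Cons x ys)
  then have len: "length ys = Suc n" by simp
  show ?case
  proof (cases "distinct ys")
    case False
    then obtain m where n: "n = Suc m" using len by (cases n) (auto simp: length_Suc_conv)
    have "alt_sum2 (\<lambda>y z r. G y z (x # r)) ys = 0"
      by (rule Cons.IH[of m]) (use Cons.prems n False in \<open>auto intro: alternating_Cons\<close>)
    then show ?thesis
      using alt_sum_not_distinct[OF Cons.prems(1) len False] by simp
  next
    case True
    then show ?thesis using alt_sum2_at[of n G ys x] Cons.prems len by simp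
  qed
qed simp

lemma alternating_alt_sum:
  assumes "\<And>y. alternating s1 s2 n (G y)"
    and "\<And>r. length r = n \<Longrightarrow> module_hom s1 s2 (\<lambda>y. G y r)"
  shows "alternating s1 s2 (Suc n) (alt_sum G)"
  using hom_alt_sum_update[OF assms] alt_sum_not_distinct[OF assms(1)] by (auto simp: alternating_def)

lemma alternating_alt_sum2:
  assumes "\<And>y z. alternating s1 s2 n (G y z)"
    and "\<And>z r. length r = n \<Longrightarrow> module_hom s1 s2 (\<lambda>y. G y z r)"
    and "\<And>y r. length r = n \<Longrightarrow> module_hom s1 s2 (\<lambda>z. G y z r)"
    and "\<And>y r. length r = n \<Longrightarrow> G y y r = 0"
  shows "alternating s1 s2 (Suc (Suc n)) (alt_sum2 G)"
proof -
  have "G y z r + G z y r = 0" if "length r = n" for y z r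
    using skew_if_self_zero[of s1 s2 "\<lambda>y z. G y z r" y z] assms that by simp
  then show ?thesis
    using hom_alt_sum2_update[OF assms(1-3)] alt_sum2_not_distinct[of n G] assms(1,4)
    by (auto simp: alternating_def)
qed

lemma alternating_add:
  "alternating s1 s2 n g \<Longrightarrow> alternating s1 s2 n h \<Longrightarrow> alternating s1 s2 n (\<lambda>xs. g xs + h xs)"
  by (simp add: alternating_def module_hom_add)

end

context module
begin

lemma alt_sum_eq_sum:
  "alt_sum G xs = (\<Sum>i<length xs. scale ((-1) ^ i) (G (xs ! i) (nths xs (- {i}))))"
proof (induction xs arbitrary: G)
  case (Cons x xs)
  have [simp]: "{j. j \<noteq> i} = - {i}" for i :: nat by auto
  show ?case
    by (simp add: Cons.IH sum.lessThan_Suc_shift nths_Cons sum_negf nths_all del: sum.lessThan_Suc)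
qed simp

lemma alt_sum2_eq_sum:
  "alt_sum2 G xs = (\<Sum>j<length xs. \<Sum>i<j.
     scale ((-1) ^ (i + j)) (G (xs ! i) (xs ! j) (nths xs (- {i, j}))))"
proof (induction xs arbitrary: G)
  case (Cons x xs)
  have [simp]: "{k. k \<noteq> j} = - {j}" "{k. k \<noteq> i \<and> k \<noteq> j} = - {i, j}"
    for i j :: nat by auto
  show ?case
    by (simp add: Cons.IH alt_sum_eq_sum sum.lessThan_Suc_shift nths_Cons sum_negf sum_subtractf
        del: sum.lessThan_Suc)
qed simp

end

lemma alternating_cong:
  assumes "alternating s1 s2 n g" and "\<And>xs. length xs = n \<Longrightarrow> g xs = h xs"
  shows "alternating s1 s2 n h"
  using assms by (simp add: alternating_def)

context hom_lie_rinehart_left_module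
begin

interpretation LM: module_pair scaleL scaleM ..

abbreviation C :: "nat \<Rightarrow> ('l list \<Rightarrow> 'm) set"
  where "C n \<equiv> cochains scaleL actL \<phi> \<alpha> scaleM actM \<beta> n"

abbreviation d :: "nat \<Rightarrow> ('l list \<Rightarrow> 'm) \<Rightarrow> 'l list \<Rightarrow> 'm"
  where "d n \<equiv> coboundary bracket \<alpha> scaleM \<theta> n"

lemma mem_cochains_iff:
  "f \<in> C n \<longleftrightarrow> (\<forall>xs. length xs \<noteq> n \<longrightarrow> f xs = 0) \<and> alternating scaleL scaleM n f \<and>
     (\<forall>xs. length xs = n \<longrightarrow> f (map \<alpha> xs) = \<beta> (f xs)) \<and>
     (\<forall>xs i a. length xs = n \<longrightarrow> i < n \<longrightarrow>
        f (xs[i := actL a (xs ! i)]) = actM ((\<phi> ^^ (n - 1)) a) (f xs))"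
  by (simp add: cochains_def alternating_maps_def alternating_def)

lemma coboundary_eq:
  "length xs = Suc n \<Longrightarrow> d n f xs =
     alt_sum (\<lambda>x r. \<theta> ((\<alpha> ^^ (n - 1)) x) (f r)) xs + alt_sum2 (\<lambda>x y r. f (bracket x y # map \<alpha> r)) xs"
  unfolding M.V.alt_sum_eq_sum M.V.alt_sum2_eq_sum by (simp add: coboundary_def)

lemma alpha_funpow_linear: "module_hom scaleL scaleL (\<alpha> ^^ k)"
proof (induction k)
  case 0
  show ?case by unfold_locales auto
next
  case (Suc k)
  then show ?case using module_hom_compose[OF Suc A.alpha_linear] by (simp add: o_def)
qed

lemma alpha_funpow_bracket: "(\<alpha> ^^ k) (bracket x y) = bracket ((\<alpha> ^^ k) x) ((\<alpha> ^^ k) y)"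
  by (induction k) (auto simp: A.alpha_bracket)

lemma alpha_funpow_act: "(\<alpha> ^^ k) (actL a x) = actL ((\<phi> ^^ k) a) ((\<alpha> ^^ k) x)"
  by (induction k) (auto simp: alpha_act)

lemma rho_funpow: "\<rho> ((\<alpha> ^^ k) x) ((\<phi> ^^ k) a) = (\<phi> ^^ k) (\<rho> x a)"
  by (induction k) (use A.theta_beta in \<open>auto simp: fun_eq_iff\<close>)

lemma theta_beta_apply: "\<theta> (\<alpha> x) (\<beta> m) = \<beta> (\<theta> x m)"
  using M.theta_beta by (simp add: fun_eq_iff)

lemma bracket_skew: "bracket x y = - bracket y x"
  by (rule skew_if_self_zero) (rule A.bracket_linear_left A.bracket_linear_right A.bracket_self)+

lemma bracket_act_left: "bracket (actL a x) y = actL (\<phi> a) (bracket x y) - actL (\<rho> y a) (\<alpha> x)"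
proof -
  have "bracket (actL a x) y = - (actL (\<phi> a) (bracket y x) + actL (\<rho> y a) (\<alpha> x))"
    by (subst bracket_skew) (simp add: bracket_act)
  also have "\<dots> = actL (\<phi> a) (- bracket y x) - actL (\<rho> y a) (\<alpha> x)"
    by (simp add: module_hom.neg[OF L.act_linear_right])
  finally show ?thesis using bracket_skew[of x y] by simp
qed

lemma coboundary_alternating:
  assumes "alternating scaleL scaleM (Suc m) f"
  shows "alternating scaleL scaleM (Suc (Suc m)) (d (Suc m) f)"
proof (rule alternating_cong[OF LM.alternating_add[OF LM.alternating_alt_sum LM.alternating_alt_sum2]])
  show "alternating scaleL scaleM (Suc m) (\<lambda>r. \<theta> ((\<alpha> ^^ m) y) (f r))" for y
    by (rule alternating_compose[OF assms M.theta_endo])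
  show "module_hom scaleL scaleM (\<lambda>y. \<theta> ((\<alpha> ^^ m) y) (f r))" for r
    using module_hom_compose[OF alpha_funpow_linear M.theta_linear] by (simp add: o_def)
  show "alternating scaleL scaleM m (\<lambda>r. f (bracket y z # map \<alpha> r))" for y z
    by (rule alternating_map[OF alternating_Cons[OF assms] A.alpha_linear])
  show "module_hom scaleL scaleM (\<lambda>y. f (bracket y z # map \<alpha> r))"
    and "module_hom scaleL scaleM (\<lambda>y. f (bracket z y # map \<alpha> r))" if "length r = m" for z r
    using module_hom_compose[OF A.bracket_linear_left alternating_head[OF assms]]
      module_hom_compose[OF A.bracket_linear_right alternating_head[OF assms]] that
    by (auto simp: o_def)
  show "f (bracket y y # map \<alpha> r) = 0" if "length r = m" for y r
    using module_hom.zero[OF alternating_head[OF assms]] that by (simp add: A.bracket_self)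
qed (simp add: coboundary_eq)

lemma coboundary_map:
  assumes f: "f \<in> C n" and "n \<ge> 1" and len: "length xs = Suc n"
  shows "d n f (map \<alpha> xs) = \<beta> (d n f xs)"
proof -
  have equiv: "f (map \<alpha> r) = \<beta> (f r)" if "length r = n" for r
    using f that by (simp add: mem_cochains_iff)
  have "d n f (map \<alpha> xs) =
      alt_sum (\<lambda>x r. \<beta> (\<theta> ((\<alpha> ^^ (n - 1)) x) (f r))) xs +
      alt_sum2 (\<lambda>x y r. \<beta> (f (bracket x y # map \<alpha> r))) xs"
    unfolding coboundary_eq[of "map \<alpha> xs" n, unfolded length_map, OF len] alt_sum_map alt_sum2_map
  proof (intro arg_cong2[where f = "(+)"] alt_sum_cong alt_sum2_cong)
    fix x r assume "mset xs = add_mset x (mset r)"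
    then have "length r = n" using mset_eq_add_mset_D(2) len by fastforce
    then show "\<theta> ((\<alpha> ^^ (n - 1)) (\<alpha> x)) (f (map \<alpha> r)) = \<beta> (\<theta> ((\<alpha> ^^ (n - 1)) x) (f r))"
      by (simp add: equiv funpow_swap1[symmetric] theta_beta_apply)
  next
    fix x y r assume *: "mset xs = add_mset x (add_mset y (mset r))"
    have "length (bracket x y # map \<alpha> r) = n"
      using arg_cong[OF *, of size] len by simp
    from equiv[OF this]
    show "f (bracket (\<alpha> x) (\<alpha> y) # map \<alpha> (map \<alpha> r)) = \<beta> (f (bracket x y # map \<alpha> r))"
      by (simp add: A.alpha_bracket)
  qed
  also have "\<dots> = \<beta> (d n f xs)"
    unfolding coboundary_eq[OF len] module_hom.add[OF M.beta_linear]
      alt_sum_image[where h = \<beta>, OF module_hom.diff[OF M.beta_linear]]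
      alt_sum2_image[where h = \<beta>, OF module_hom.diff[OF M.beta_linear]] ..
  finally show ?thesis .
qed

text \<open>
  The two corrections, from \<open>\<theta>\<close> applied to a multiple of \<open>f (x # r)\<close> and from the bracket with
  \<open>a.x\<close>, cancel because \<open>\<rho>\<close> intertwines the powers of \<open>\<alpha>\<close> and \<open>\<phi>\<close>.
\<close>

lemma coboundary_act_head:
  assumes f: "f \<in> C (Suc m)" and len: "length ys = Suc m"
  shows "d (Suc m) f (actL a x # ys) = actM ((\<phi> ^^ Suc m) a) (d (Suc m) f (x # ys))"
proof -
  let ?act = "actM ((\<phi> ^^ Suc m) a)"
  have alt: "alternating scaleL scaleM (Suc m) f"
    and equiv: "\<And>r. length r = Suc m \<Longrightarrow> f (map \<alpha> r) = \<beta> (f r)"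
    and act: "\<And>xs i b. length xs = Suc m \<Longrightarrow> i < Suc m \<Longrightarrow>
        f (xs[i := actL b (xs ! i)]) = actM ((\<phi> ^^ m) b) (f xs)"
    using f by (simp_all add: mem_cochains_iff)
  have act0: "f (actL b z # r) = actM ((\<phi> ^^ m) b) (f (z # r))" if "length r = m" for b z r
    using act[of "z # r" 0 b] that by simp
  have act1: "f (w # actL b z # r) = actM ((\<phi> ^^ m) b) (f (w # z # r))"
    if "Suc (length r) = m" for b w z r
    using act[of "w # z # r" 1 b] that by simp
  have pow: "(\<phi> ^^ m) (\<phi> b) = (\<phi> ^^ Suc m) b" for b
    by (simp add: funpow_swap1)
  define E where "E y r = actM ((\<phi> ^^ m) (\<rho> y a)) (\<beta> (f (x # r)))" for y r
  have "alt_sum (\<lambda>y r. \<theta> ((\<alpha> ^^ m) y) (f (actL a x # r))) ys =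
      alt_sum (\<lambda>y r. ?act (\<theta> ((\<alpha> ^^ m) y) (f (x # r))) + E y r) ys"
  proof (rule alt_sum_cong)
    fix y r assume "mset ys = add_mset y (mset r)"
    then have "length r = m" using mset_eq_add_mset_D(2) len by fastforce
    then show "\<theta> ((\<alpha> ^^ m) y) (f (actL a x # r)) = ?act (\<theta> ((\<alpha> ^^ m) y) (f (x # r))) + E y r"
      by (simp add: act0 theta_act_right rho_funpow E_def)
  qed
  moreover have "alt_sum (\<lambda>y r. f (bracket (actL a x) y # map \<alpha> r)) ys =
      alt_sum (\<lambda>y r. ?act (f (bracket x y # map \<alpha> r)) - E y r) ys"
  proof (rule alt_sum_cong)
    fix y r assume "mset ys = add_mset y (mset r)"
    then have r: "length (map \<alpha> r) = m" using mset_eq_add_mset_D(2) len by fastforce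
    show "f (bracket (actL a x) y # map \<alpha> r) = ?act (f (bracket x y # map \<alpha> r)) - E y r"
      using equiv[of "x # r"] r
      by (simp only: bracket_act_left module_hom.diff[OF alternating_head[OF alt r]] act0 pow E_def)
        simp
  qed
  moreover have "alt_sum2 (\<lambda>y z r. f (bracket y z # map \<alpha> (actL a x # r))) ys =
      alt_sum2 (\<lambda>y z r. ?act (f (bracket y z # map \<alpha> (x # r)))) ys"
  proof (rule alt_sum2_cong)
    fix y z r assume *: "mset ys = add_mset y (add_mset z (mset r))"
    have "Suc (length (map \<alpha> r)) = m" using arg_cong[OF *, of size] len by simp
    then show "f (bracket y z # map \<alpha> (actL a x # r)) = ?act (f (bracket y z # map \<alpha> (x # r)))"
      by (simp only: list.map alpha_act act1 pow)
  qed
  moreover have "\<theta> ((\<alpha> ^^ m) (actL a x)) (f ys) = ?act (\<theta> ((\<alpha> ^^ m) x) (f ys))"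
    by (simp add: alpha_funpow_act theta_act_left)
  ultimately show ?thesis
    using len
    by (simp add: coboundary_eq alt_sum_add alt_sum_diff module_hom.add[OF M.act_linear_right]
        module_hom.diff[OF M.act_linear_right]
        alt_sum_image[where h = ?act, OF module_hom.diff[OF M.act_linear_right]]
        alt_sum2_image[where h = ?act, OF module_hom.diff[OF M.act_linear_right]]
        del: funpow.simps list.map)
qed

lemma coboundary_cochain:
  assumes f: "f \<in> C n" and "n \<ge> 1"
  shows "d n f \<in> C (Suc n)"
proof -
  obtain m where n: "n = Suc m" using \<open>n \<ge> 1\<close> by (cases n) auto
  have alt: "alternating scaleL scaleM (Suc n) (d n f)"
    unfolding n by (rule coboundary_alternating) (use f n in \<open>simp add: mem_cochains_iff\<close>)
  have "d n f (xs[i := actL a (xs ! i)]) = actM ((\<phi> ^^ n) a) (d n f xs)"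
    if len: "length xs = Suc n" and i: "i < Suc n" for xs i a
  proof -
    define u v x where "u = take i xs" and "v = drop (Suc i) xs" and "x = xs ! i"
    have xs: "xs = u @ x # v" and upd: "xs[i := actL a x] = u @ actL a x # v"
      unfolding u_def v_def x_def using len i
      by (auto intro: id_take_nth_drop upd_conv_take_nth_drop)
    have uv: "length (u @ v) = n" using xs len by simp
    have "d n f (u @ actL a x # v) = scaleM ((-1) ^ length u) (d n f (actL a x # u @ v))"
      by (rule LM.alternating_move_to_front[OF alt]) (use uv in simp)
    also have "\<dots> = scaleM ((-1) ^ length u) (actM ((\<phi> ^^ n) a) (d n f (x # u @ v)))"
      using coboundary_act_head[of f m "u @ v" a x] f uv n by simp
    also have "\<dots> = actM ((\<phi> ^^ n) a) (scaleM ((-1) ^ length u) (d n f (x # u @ v)))"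
      by (simp add: module_hom.scale[OF M.act_linear_right])
    also have "scaleM ((-1) ^ length u) (d n f (x # u @ v)) = d n f (u @ x # v)"
      by (rule LM.alternating_move_to_front[OF alt, symmetric]) (use uv in simp)
    finally show ?thesis unfolding x_def[symmetric] upd xs[symmetric] .
  qed
  moreover have "d n f xs = 0" if "length xs \<noteq> Suc n" for xs
    using that by (simp add: coboundary_def)
  ultimately show ?thesis
    using alt coboundary_map[OF assms] by (simp add: mem_cochains_iff)
qed

lemma coboundary_coboundary:
  assumes f: "f \<in> C n" and "n \<ge> 1"
  shows "d (Suc n) (d n f) xs = 0"
proof (cases "length xs = Suc (Suc n)")
  case True
  obtain m where n: "n = Suc m" using \<open>n \<ge> 1\<close> by (cases n) auto
  have alt: "alternating scaleL scaleM (Suc m) f"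
    and equiv: "\<And>r. length r = Suc m \<Longrightarrow> f (map \<alpha> r) = \<beta> (f r)"
    and out: "\<And>r. length r \<noteq> Suc m \<Longrightarrow> f r = 0"
    using f n by (simp_all add: mem_cochains_iff)
  have equiv_out: "f (map \<alpha> r) = \<beta> (f r)" for r
    using equiv[of r] out[of r] out[of "map \<alpha> r"] module_hom.zero[OF M.beta_linear] by fastforce
  have head: "f ((u + v) # r) = f (u # r) + f (v # r)" and head_zero: "f (0 # r) = 0" for u v r
    using module_hom.add[OF alternating_head[OF alt]] module_hom.zero[OF alternating_head[OF alt]]
      out[of "_ # r"] by (cases "length r = m"; simp)+
  have head_minus: "f ((- u) # r) = - f (u # r)" for u r
    using head[of u "- u" r] head_zero[of r] by (simp add: add_eq_0_iff)
  have swap: "f (u # v # r) = - f (v # u # r)" for u v r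
    using alternating_swap[of scaleL scaleM "length r" f r u v] alt out[of "u # v # r"]
      out[of "v # u # r"] by (cases "m = Suc (length r)") auto
  note theta_sums = alt_sum_image[where h = "\<theta> _", OF module_hom.diff[OF M.theta_endo]]
    alt_sum2_image[where h = "\<theta> _", OF module_hom.diff[OF M.theta_endo]]
  let ?A = "\<lambda>x y r. \<theta> ((\<alpha> ^^ n) x) (\<theta> ((\<alpha> ^^ m) y) (f r))"
  let ?B = "\<lambda>x y z r. \<theta> ((\<alpha> ^^ n) x) (f (bracket y z # map \<alpha> r))"
  let ?J = "\<lambda>x y z r. f (bracket (bracket x y) (\<alpha> z) # map \<alpha> (map \<alpha> r))"
  let ?K = "\<lambda>x y z w r. f (bracket (\<alpha> z) (\<alpha> w) # \<alpha> (bracket x y) # map \<alpha> (map \<alpha> r))"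
  have AB: "alt_sum (\<lambda>x r. \<theta> ((\<alpha> ^^ n) x) (d n f r)) xs =
      alt_sum (\<lambda>x. alt_sum (?A x)) xs + alt_sum (\<lambda>x. alt_sum2 (?B x)) xs"
    unfolding alt_sum_add[symmetric]
  proof (rule alt_sum_cong)
    fix x r assume "mset xs = add_mset x (mset r)"
    then have "length r = Suc n" using mset_eq_add_mset_D(2) True by fastforce
    then show "\<theta> ((\<alpha> ^^ n) x) (d n f r) = alt_sum (?A x) r + alt_sum2 (?B x) r"
      by (simp add: coboundary_eq n module_hom.add[OF M.theta_endo] theta_sums del: funpow.simps)
  qed
  have CD: "alt_sum2 (\<lambda>x y r. d n f (bracket x y # map \<alpha> r)) xs =
      alt_sum2 (\<lambda>x y r. ?A x y r - ?A y x r) xs - alt_sum2 (\<lambda>y z. alt_sum (\<lambda>x. ?B x y z)) xs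
      + alt_sum2 (\<lambda>x y. alt_sum2 (?K x y)) xs - alt_sum2 (\<lambda>x y. alt_sum (?J x y)) xs"
    unfolding alt_sum2_add[symmetric] alt_sum2_diff[symmetric]
  proof (rule alt_sum2_cong)
    fix x y r assume *: "mset xs = add_mset x (add_mset y (mset r))"
    have "length (bracket x y # map \<alpha> r) = Suc n"
      using arg_cong[OF *, of size] True by simp
    moreover have "\<theta> ((\<alpha> ^^ m) (bracket x y)) (f (map \<alpha> r)) = ?A x y r - ?A y x r"
      by (simp add: equiv_out alpha_funpow_bracket M.theta_bracket n)
    ultimately show "d n f (bracket x y # map \<alpha> r) =
        ?A x y r - ?A y x r - alt_sum (\<lambda>z. ?B z x y) r + alt_sum2 (?K x y) r - alt_sum (?J x y) r"
      by (simp add: coboundary_eq n alt_sum_map alt_sum2_map funpow_swap1)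
  qed
  have J: "alt_sum2 (\<lambda>x y. alt_sum (?J x y)) xs = 0"
  proof (rule alt_sum2_alt_sum_cyclic)
    show "?J x y z r = - ?J y x z r" for x y z r
      unfolding head_minus[symmetric]
      using bracket_skew[of x y] module_hom.neg[OF A.bracket_linear_left] by simp
    have "bracket (bracket x y) (\<alpha> z) + bracket (bracket y z) (\<alpha> x) + bracket (bracket z x) (\<alpha> y) =
        - (bracket (\<alpha> x) (bracket y z) + bracket (\<alpha> y) (bracket z x) + bracket (\<alpha> z) (bracket x y))"
      for x y z
      using bracket_skew[of "bracket x y" "\<alpha> z"] bracket_skew[of "bracket y z" "\<alpha> x"]
        bracket_skew[of "bracket z x" "\<alpha> y"] by simp
    then show "?J x y z r + ?J y z x r + ?J z x y r = 0" for x y z r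
      by (simp only: head[symmetric] A.hom_jacobi minus_zero head_zero)
  qed
  have K: "alt_sum2 (\<lambda>x y. alt_sum2 (?K x y)) xs = 0"
    by (rule alt_sum2_alt_sum2_antisym) (subst swap, simp add: A.alpha_bracket)
  show ?thesis
    unfolding coboundary_eq[OF True] diff_Suc_1 AB CD J K alt_sum_alt_sum alt_sum_alt_sum2_commute
    by (simp add: alt_sum2_diff)
qed (simp add: coboundary_def)

end

theorem proposition4p4:
  fixes scaleA :: "'r::comm_ring_1 \<Rightarrow> 'a::comm_ring \<Rightarrow> 'a"
    and scaleL :: "'r \<Rightarrow> 'l::ab_group_add \<Rightarrow> 'l"
    and actL :: "'a \<Rightarrow> 'l \<Rightarrow> 'l"
    and bracket :: "'l \<Rightarrow> 'l \<Rightarrow> 'l"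
    and \<phi> :: "'a \<Rightarrow> 'a"
    and \<alpha> :: "'l \<Rightarrow> 'l"
    and \<rho> :: "'l \<Rightarrow> 'a \<Rightarrow> 'a"
    and scaleM :: "'r \<Rightarrow> 'm::ab_group_add \<Rightarrow> 'm"
    and actM :: "'a \<Rightarrow> 'm \<Rightarrow> 'm"
    and \<theta> :: "'l \<Rightarrow> 'm \<Rightarrow> 'm"
    and \<beta> :: "'m \<Rightarrow> 'm"
    and n :: nat
    and f :: "'l list \<Rightarrow> 'm"
  assumes "hom_lie_rinehart_algebra scaleA scaleL actL bracket \<phi> \<alpha> \<rho>"
    and "bij \<phi>"
    and "hom_lie_rinehart_left_module scaleA scaleL actL bracket \<phi> \<alpha> \<rho> scaleM actM \<theta> \<beta>"
    and "n \<ge> 1"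
    and "f \<in> cochains scaleL actL \<phi> \<alpha> scaleM actM \<beta> n"
  shows "coboundary bracket \<alpha> scaleM \<theta> n f \<in> cochains scaleL actL \<phi> \<alpha> scaleM actM \<beta> (n + 1)
     \<and> coboundary bracket \<alpha> scaleM \<theta> (n + 1) (coboundary bracket \<alpha> scaleM \<theta> n f) = (\<lambda>_. 0)"
proof -
  interpret hom_lie_rinehart_left_module scaleA scaleL actL bracket \<phi> \<alpha> \<rho> scaleM actM \<theta> \<beta>
    by (rule assms(3))
  show ?thesis
    using coboundary_cochain[OF assms(5,4)] coboundary_coboundary[OF assms(5,4)]
    by (simp add: fun_eq_iff)
qed

end
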